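(* Let $\mathbb F\in\{\mathbb R,\mathbb C\}$, let $\mathcal H\subseteq\mathbb F^M$ be an $m$-dimensional subspace, and let $\Phi=\{\boldsymbol\varphi_1,\dots,\boldsymbol\varphi_N\}\subset\mathcal H$ be a unit-norm tight frame for $\mathcal H$ with $\gamma_\Phi>0$. Let $J\subseteq\{1,\dots,N\}$ be non-empty and $w_i>0$ for $i\in J$. Then the operator $S_{J,w}=\sum_{i\in J}w_iP_i$ on $\mathcal H$ satisfies $$\frac{\|S_{J,w}\|_{\rm HS}^2}{(\operatorname{trace}S_{J,w})^2}\ge\frac1m+\gamma_\Phi\Big(\frac1{|J|}-\frac1N\Big).$$
   Context: A family $\Phi=\{\boldsymbol\varphi_1,\dots,\boldsymbol\varphi_N\}\subset\mathcal H$ is a unit-norm tight frame (UNTF) for the $m$-dimensional space $\mathcal H$ if $\|\boldsymbol\varphi_i\|_2=1$ for all $i$ and $\sum_{i=1}^N|\langle\boldsymbol a,\boldsymbol\varphi_i\rangle|^2=\frac Nm\|\boldsymbol a\|_2^2$ for all $\boldsymbol a\in\mathcal H$. Define on $\mathcal H$ the operators $P_i\boldsymbol a=\langle\boldsymbol a,\boldsymbol\varphi_i\rangle\boldsymbol\varphi_i$ and $Q_i=P_i-\frac1m\mathrm{Id}_{\mathcal H}$, and the real symmetric Gram matrix $\boldsymbol G_\Phi=[\operatorname{trace}(Q_iQ_j)]_{i,j=1}^N\in\mathbb R^{N\times N}$. It satisfies $\boldsymbol G_\Phi\boldsymbol 1_N=\boldsymbol 0$, where $\boldsymbol 1_N$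 is the all-ones vector. Define $\gamma_\Phi=\lambda_{\min}(\boldsymbol G_\Phi|_{\boldsymbol 1_N^\perp})$, the smallest eigenvalue of $\boldsymbol G_\Phi$ on the orthogonal complement of $\boldsymbol 1_N$ (with $N\ge2$, so that this complement is nonzero). $\|\cdot\|_{\rm HS}$ is the Hilbert--Schmidt norm. *)

theory Defs
  imports "HOL-Analysis.Analysis"
begin

section \<open>Scalars\<close>

text \<open>
  The scalar field is the real or the complex numbers. By the Gelfand--Mazur theorem every
  real normed field is isomorphic to one of the two, and the second axiom determines
  conjugation (and the third one the real part), so the class has no other models.
\<close>

class real_or_complex = real_normed_field +
  fixes conjg :: "'a \<Rightarrow> 'a" and re :: "'a \<Rightarrow> real"
  assumes conjg_add: "conjg (x + y) = conjg x + conjg y"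
    and mult_conjg_scaleR: "x * conjg x = (norm x)\<^sup>2 *\<^sub>R 1"
    and add_conjg_scaleR: "x + conjg x = (2 * re x) *\<^sub>R 1"

instantiation real :: real_or_complex
begin
definition conjg_real :: "real \<Rightarrow> real" where "conjg_real x = x"
definition re_real :: "real \<Rightarrow> real" where "re_real x = x"
instance by standard (simp_all add: conjg_real_def re_real_def power2_eq_square)
end

instantiation complex :: real_or_complex
begin
definition conjg_complex :: "complex \<Rightarrow> complex" where "conjg_complex z = cnj z"
definition re_complex :: "complex \<Rightarrow> real" where "re_complex z = Re z"
instance
proof
  fix x y :: complex
  show "conjg (x + y) = conjg x + conjg y" by (simp add: conjg_complex_def)
  show "x * conjg x = (norm x)\<^sup>2 *\<^sub>R 1"
    unfolding conjg_complex_def scaleR_conv_of_real by (simp only: complex_norm_square mult_1_right)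
  show "x + conjg x = (2 * re x) *\<^sub>R 1"
    by (simp add: conjg_complex_def re_complex_def complex_eq_iff)
qed
end


section \<open>Inner product, trace and Hilbert--Schmidt norm\<close>

text \<open>The inner product is linear in its first argument.\<close>

definition ip :: "'a::real_or_complex ^ 'M \<Rightarrow> 'a ^ 'M \<Rightarrow> 'a" where
  "ip x y = (\<Sum>k\<in>UNIV. x $ k * conjg (y $ k))"

definition basis_of :: "('a::field ^ 'M) set \<Rightarrow> ('a ^ 'M) set \<Rightarrow> bool" where
  "basis_of H B \<longleftrightarrow> \<not> vec.dependent B \<and> vec.span B = H"

definition orthonormal_basis_of ::
    "('a::real_or_complex ^ 'M) set \<Rightarrow> ('a ^ 'M) set \<Rightarrow> bool" where
  "orthonormal_basis_of H B \<longleftrightarrow>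
     basis_of H B \<and> (\<forall>b\<in>B. \<forall>c\<in>B. ip b c = (if b = c then 1 else 0))"

text \<open>
  An operator on a subspace \<open>H\<close> is represented by a function on the ambient space that maps
  \<open>H\<close> into \<open>H\<close> linearly; the two notions below only depend on its values on \<open>H\<close>. They are the
  sum of the diagonal entries of the matrix with respect to a basis of \<open>H\<close>, and
  \<open>(\<Sum>b\<in>B. \<parallel>T b\<parallel>\<^sup>2)\<^sup>1\<^sup>/\<^sup>2\<close> for an orthonormal basis \<open>B\<close> of \<open>H\<close>. Lemmas \<open>trace_on_eq\<close>,
  \<open>orthonormal_basis_exists\<close> and \<open>hs_norm_on_eq\<close> show that the choices are possible
  and immaterial.
\<close>

definition trace_on ::
    "('a::field ^ 'M) set \<Rightarrow> ('a ^ 'M \<Rightarrow> 'a ^ 'M) \<Rightarrow> 'a" where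
  "trace_on H T = (let B = SOME B. basis_of H B
                   in \<Sum>b\<in>B. vec.representation B (T b) b)"

definition hs_norm_on ::
    "('a::real_or_complex ^ 'M) set \<Rightarrow> ('a ^ 'M \<Rightarrow> 'a ^ 'M) \<Rightarrow> real" where
  "hs_norm_on H T = (let B = SOME B. orthonormal_basis_of H B
                     in sqrt (\<Sum>b\<in>B. (norm (T b))\<^sup>2))"


section \<open>Unit-norm tight frames\<close>

definition unit_norm_tight_frame ::
    "('a::real_or_complex ^ 'M) set \<Rightarrow> ('N::finite \<Rightarrow> 'a ^ 'M) \<Rightarrow> bool" where
  "unit_norm_tight_frame H \<phi> \<longleftrightarrow>
     (\<forall>i. \<phi> i \<in> H) \<and> (\<forall>i. norm (\<phi> i) = 1) \<and>
     (\<forall>a\<in>H. (\<Sum>i\<in>UNIV. (norm (ip a (\<phi> i)))\<^sup>2)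
              = real CARD('N) / real (vec.dim H) * (norm a)\<^sup>2)"

definition P_op :: "('N \<Rightarrow> 'a::real_or_complex ^ 'M) \<Rightarrow> 'N \<Rightarrow> 'a ^ 'M \<Rightarrow> 'a ^ 'M" where
  "P_op \<phi> i a = ip a (\<phi> i) *s \<phi> i"

definition Q_op ::
    "('a::real_or_complex ^ 'M) set \<Rightarrow> ('N \<Rightarrow> 'a ^ 'M) \<Rightarrow> 'N \<Rightarrow> 'a ^ 'M \<Rightarrow> 'a ^ 'M" where
  "Q_op H \<phi> i a = P_op \<phi> i a - (1 / real (vec.dim H)) *\<^sub>R a"

text \<open>The traces below are real, being traces of products of two self-adjoint operators;
  \<open>re\<close> only changes their type.\<close>

definition gram_matrix ::
    "('a::real_or_complex ^ 'M) set \<Rightarrow> ('N::finite \<Rightarrow> 'a ^ 'M) \<Rightarrow> real ^ 'N ^ 'N" where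
  "gram_matrix H \<phi> = (\<chi> i j. re (trace_on H (Q_op H \<phi> i \<circ> Q_op H \<phi> j)))"

definition eigenvalues_on :: "real ^ 'N ^ 'N \<Rightarrow> (real ^ 'N) set \<Rightarrow> real set" where
  "eigenvalues_on A V = {c. \<exists>v\<in>V. v \<noteq> 0 \<and> A *v v = c *\<^sub>R v}"

text \<open>Here \<open>1 :: real ^ 'N\<close> is the all-ones vector.\<close>

definition gamma_frame ::
    "('a::real_or_complex ^ 'M) set \<Rightarrow> ('N::finite \<Rightarrow> 'a ^ 'M) \<Rightarrow> real" where
  "gamma_frame H \<phi> = Min (eigenvalues_on (gram_matrix H \<phi>) ({1}\<^sup>\<bottom>))"

definition S_op ::
    "('N \<Rightarrow> 'a::real_or_complex ^ 'M) \<Rightarrow> 'N set \<Rightarrow> ('N \<Rightarrow> real) \<Rightarrow> 'a ^ 'M \<Rightarrow> 'a ^ 'M" where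
  "S_op \<phi> J w a = (\<Sum>i\<in>J. w i *\<^sub>R P_op \<phi> i a)"


section \<open>Trace and Hilbert--Schmidt norm are well defined\<close>

lemma conjg_0 [simp]: "conjg 0 = (0::'a::real_or_complex)"
  using conjg_add[of 0 "0::'a"] by simp

lemma mult_conjg: "x * conjg x = of_real ((norm (x::'a::real_or_complex))\<^sup>2)"
  using mult_conjg_scaleR[of x] by (simp add: scaleR_conv_of_real)

lemma add_conjg: "x + conjg x = of_real (2 * re (x::'a::real_or_complex))"
  using add_conjg_scaleR[of x] by (simp add: scaleR_conv_of_real)

lemma conjg_eq: "conjg (x::'a::real_or_complex) = of_real ((norm x)\<^sup>2) / x"
  using mult_conjg[of x] by (cases "x = 0") (auto simp: field_simps)

lemma conjg_mult: "conjg (x * y) = conjg x * conjg (y::'a::real_or_complex)"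
  by (simp add: conjg_eq norm_mult power_mult_distrib)

lemma conjg_of_real [simp]: "conjg (of_real r) = (of_real r::'a::real_or_complex)"
  by (cases "r = 0") (simp_all add: conjg_eq power2_eq_square)

lemma conjg_conjg [simp]: "conjg (conjg x) = (x::'a::real_or_complex)"
proof -
  have "conjg x + conjg (conjg x) = conjg (x + conjg x)" by (simp only: conjg_add)
  also have "\<dots> = x + conjg x" by (simp only: add_conjg conjg_of_real)
  finally show ?thesis by simp
qed

lemma conjg_sum: "conjg (sum f A) = (\<Sum>i\<in>A. conjg (f i::'a::real_or_complex))"
  by (induction A rule: infinite_finite_induct) (simp_all add: conjg_add)

lemma ip_add_left: "ip (x + y) z = ip x z + ip y z"
  by (simp add: ip_def sum.distrib distrib_right)

lemma ip_scale_left: "ip (c *s x) z = c * ip x z"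
  by (simp add: ip_def sum_distrib_left mult.assoc)

lemma conjg_ip: "conjg (ip x y) = ip y x"
  by (simp add: ip_def conjg_sum conjg_mult mult.commute)

lemma ip_scale_right: "ip x (c *s z) = conjg c * ip x z"
  by (metis conjg_ip conjg_mult ip_scale_left)

lemma ip_zero_left [simp]: "ip 0 z = 0"
  by (simp add: ip_def)

lemma ip_sum_left: "ip (sum f A) z = (\<Sum>i\<in>A. ip (f i) z)"
  by (induction A rule: infinite_finite_induct) (simp_all add: ip_add_left)

lemma ip_sum_right: "ip z (sum f A) = (\<Sum>i\<in>A. ip z (f i))"
proof -
  have "ip z (sum f A) = conjg (ip (sum f A) z)" by (simp add: conjg_ip)
  also have "\<dots> = (\<Sum>i\<in>A. ip z (f i))" by (simp add: ip_sum_left conjg_sum conjg_ip)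
  finally show ?thesis .
qed

lemma ip_self: "ip x x = of_real ((norm x)\<^sup>2)"
  by (simp add: ip_def mult_conjg norm_vec_def L2_set_def sum_nonneg)

lemma trace_on_eq:
  fixes H :: "('a::field ^ 'M) set"
  assumes T: "Vector_Spaces.linear (*s) (*s) T" and TH: "\<And>x. x \<in> H \<Longrightarrow> T x \<in> H"
    and C: "basis_of H C"
  shows "trace_on H T = (\<Sum>c\<in>C. vec.representation C (T c) c)"
proof -
  interpret T: Vector_Spaces.linear "(*s)" "(*s)" T by (rule T)
  define B where "B = (SOME B. basis_of H B)"
  have B: "basis_of H B" unfolding B_def using C by (rule someI)
  have fin: "finite B" "finite C"
    using B C by (auto simp: basis_of_def vec.finiteI_independent)
  have ind: "\<not> vec.dependent B" "\<not> vec.dependent C" and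
    spn: "vec.span B = H" "vec.span C = H"
    using B C by (auto simp: basis_of_def)
  have inB: "b \<in> H" if "b \<in> B" for b using spn(1) that vec.span_base by blast
  have inC: "c \<in> H" if "c \<in> C" for c using spn(2) that vec.span_base by blast
  have sc: "c *s x \<in> H" if "x \<in> H" for c x
    using vec.span_scale[of x B c] that spn by simp
  have exB: "(\<Sum>b\<in>B. vec.representation B x b *s b) = x" if "x \<in> H" for x
    using vec.sum_representation_eq[OF ind(1) _ fin(1) order_refl] that spn by simp
  have exC: "(\<Sum>c\<in>C. vec.representation C x c *s c) = x" if "x \<in> H" for x
    using vec.sum_representation_eq[OF ind(2) _ fin(2) order_refl] that spn by simp
  have repB: "vec.representation B (\<Sum>c\<in>C. f c *s T c) b
      = (\<Sum>c\<in>C. f c * vec.representation B (T c) b)" for f b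
  proof -
    have "vec.representation B (\<Sum>c\<in>C. f c *s T c) b
        = (\<Sum>c\<in>C. vec.representation B (f c *s T c) b)"
      by (subst vec.representation_sum[OF ind(1)]) (auto simp: spn TH inC intro: sc)
    also have "\<dots> = (\<Sum>c\<in>C. f c * vec.representation B (T c) b)"
      by (intro sum.cong refl, subst vec.representation_scale[OF ind(1)]) (auto simp: spn TH inC)
    finally show ?thesis .
  qed
  have repC: "vec.representation C (\<Sum>b\<in>B. f b *s b) c
      = (\<Sum>b\<in>B. f b * vec.representation C b c)" for f c
  proof -
    have "vec.representation C (\<Sum>b\<in>B. f b *s b) c
        = (\<Sum>b\<in>B. vec.representation C (f b *s b) c)"
      by (subst vec.representation_sum[OF ind(2)]) (auto simp: spn inB intro: sc)
    also have "\<dots> = (\<Sum>b\<in>B. f b * vec.representation C b c)"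
      by (intro sum.cong refl, subst vec.representation_scale[OF ind(2)]) (auto simp: spn inB)
    finally show ?thesis .
  qed
  have "trace_on H T = (\<Sum>b\<in>B. vec.representation B (T b) b)"
    by (simp add: trace_on_def B_def Let_def)
  also have "\<dots> = (\<Sum>b\<in>B. \<Sum>c\<in>C. vec.representation C b c * vec.representation B (T c) b)"
  proof (intro sum.cong refl)
    fix b assume "b \<in> B"
    then have "T b = T (\<Sum>c\<in>C. vec.representation C b c *s c)" using exC inB by simp
    also have "\<dots> = (\<Sum>c\<in>C. vec.representation C b c *s T c)" by (simp add: T.sum T.scale)
    finally show "vec.representation B (T b) b
        = (\<Sum>c\<in>C. vec.representation C b c * vec.representation B (T c) b)"
      using repB by metis
  qed
  also have "\<dots> = (\<Sum>c\<in>C. \<Sum>b\<in>B. vec.representation B (T c) b * vec.representation C b c)"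
    by (subst sum.swap) (simp add: mult.commute)
  also have "\<dots> = (\<Sum>c\<in>C. vec.representation C (T c) c)"
  proof (intro sum.cong refl)
    fix c assume "c \<in> C"
    then have "(\<Sum>b\<in>B. vec.representation B (T c) b *s b) = T c" by (intro exB TH inC)
    then show "(\<Sum>b\<in>B. vec.representation B (T c) b * vec.representation C b c)
        = vec.representation C (T c) c"
      using repC[of "vec.representation B (T c)" c] by simp
  qed
  finally show ?thesis .
qed

lemma orthonormal_independent:
  fixes B :: "('a::real_or_complex ^ 'M) set"
  assumes "\<And>b c. b \<in> B \<Longrightarrow> c \<in> B \<Longrightarrow> ip b c = (if b = c then 1 else 0)"
  shows "\<not> vec.dependent B"
proof
  assume "vec.dependent B"
  then obtain S u b where S: "finite S" "S \<subseteq> B" "b \<in> S" "u b \<noteq> 0" "(\<Sum>v\<in>S. u v *s v) = 0"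
    unfolding vec.dependent_explicit by blast
  have "0 = ip (\<Sum>v\<in>S. u v *s v) b" using S by simp
  also have "\<dots> = (\<Sum>v\<in>S. u v * ip v b)" by (simp add: ip_sum_left ip_scale_left)
  also have "\<dots> = (\<Sum>v\<in>S. if v = b then u v else 0)"
    using S assms by (intro sum.cong) (auto simp: subset_iff)
  also have "\<dots> = u b" using S by simp
  finally show False using S by simp
qed

lemma orthonormal_basis_exists:
  fixes H :: "('a::real_or_complex ^ 'M) set"
  assumes H: "vec.subspace H"
  shows "\<exists>B. orthonormal_basis_of H B"
proof -
  define on where "on = (\<lambda>B. B \<subseteq> H \<and> (\<forall>b\<in>B. \<forall>c\<in>B. ip b c = (if b = c then 1 else (0::'a))))"
  have ind: "\<not> vec.dependent B" if "on B" for B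
    using that by (intro orthonormal_independent) (auto simp: on_def)
  have "on {}" by (simp add: on_def)
  moreover have "\<forall>B. on B \<longrightarrow> card B < Suc (vec.dim H)"
    using vec.independent_card_le_dim[OF _ ind] by (auto simp: on_def less_Suc_eq_le)
  ultimately obtain B where B: "on B" and mx: "\<And>B'. on B' \<Longrightarrow> card B' \<le> card B"
    using ex_has_greatest_nat[of on "{}" card "Suc (vec.dim H)"] by (auto dest: less_imp_le)
  have fin: "finite B" using ind[OF B] by (rule vec.finiteI_independent)
  have sub: "vec.span B \<subseteq> H" using B H by (intro vec.span_minimal) (simp_all add: on_def)
  have "H \<subseteq> vec.span B"
  proof (rule ccontr)
    assume "\<not> H \<subseteq> vec.span B"
    then obtain x where x: "x \<in> H" "x \<notin> vec.span B" by blast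
    define s where "s = (\<Sum>b\<in>B. ip x b *s b)"
    define y where "y = x - s"
    have s: "s \<in> vec.span B" unfolding s_def
      by (intro vec.span_sum vec.span_scale vec.span_base)
    have y0: "y \<noteq> 0" using x s by (auto simp: y_def)
    have yH: "y \<in> H" using x s sub H by (auto simp: y_def intro: vec.subspace_diff)
    have yb: "ip y b = 0" if b: "b \<in> B" for b
    proof -
      have "ip s b = (\<Sum>v\<in>B. ip x v * ip v b)" by (simp add: s_def ip_sum_left ip_scale_left)
      also have "\<dots> = (\<Sum>v\<in>B. if v = b then ip x v else 0)"
        using B b by (intro sum.cong) (auto simp: on_def)
      also have "\<dots> = ip x b" using fin b by simp
      finally have "ip x b = ip (y + s) b" "ip s b = ip x b" by (simp_all add: y_def)
      then show ?thesis by (simp add: ip_add_left)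
    qed
    define z where "z = of_real (1 / norm y) *s y"
    have "ip z z = of_real (1 / norm y) * (of_real (1 / norm y) * of_real ((norm y)\<^sup>2))"
      unfolding z_def ip_scale_left ip_scale_right conjg_of_real ip_self[of y] ..
    also have "\<dots> = of_real (1 / norm y * (1 / norm y * (norm y)\<^sup>2))"
      by (simp only: of_real_mult)
    also have "\<dots> = 1" using y0 by (simp add: power2_eq_square)
    finally have zz: "ip z z = 1" .
    have zb: "ip z b = 0" if "b \<in> B" for b using yb that by (simp add: z_def ip_scale_left)
    have bz: "ip b z = 0" if "b \<in> B" for b using zb[OF that] conjg_ip[of z b] by simp
    have zB: "z \<notin> B" using zz zb by auto
    have "z \<in> H" unfolding z_def using yH H by (rule vec.subspace_scale[rotated])
    then have "on (insert z B)" using B zz zb bz zB by (auto simp: on_def)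
    from mx[OF this] show False using zB fin by simp
  qed
  with sub B ind[OF B] show ?thesis by (auto simp: orthonormal_basis_of_def basis_of_def on_def)
qed

lemma orthonormal_expand:
  fixes H :: "('a::real_or_complex ^ 'M) set"
  assumes B: "orthonormal_basis_of H B" and x: "x \<in> H"
  shows "x = (\<Sum>b\<in>B. ip x b *s b)"
proof -
  have ind: "\<not> vec.dependent B" and spn: "vec.span B = H"
    and on: "\<And>b c. b \<in> B \<Longrightarrow> c \<in> B \<Longrightarrow> ip b c = (if b = c then 1 else 0)"
    using B by (auto simp: orthonormal_basis_of_def basis_of_def)
  have fin: "finite B" using ind by (rule vec.finiteI_independent)
  let ?r = "vec.representation B x"
  have ex: "(\<Sum>b\<in>B. ?r b *s b) = x"
    using vec.sum_representation_eq[OF ind _ fin order_refl] x spn by simp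
  have "ip x c = ?r c" if c: "c \<in> B" for c
  proof -
    have "ip x c = (\<Sum>b\<in>B. ?r b * ip b c)"
      by (subst ex[symmetric]) (simp add: ip_sum_left ip_scale_left)
    also have "\<dots> = (\<Sum>b\<in>B. if b = c then ?r b else 0)"
      using on c by (intro sum.cong) auto
    finally show ?thesis using fin c by simp
  qed
  with ex show ?thesis by simp
qed

lemma hs_norm_on_eq:
  fixes H :: "('a::real_or_complex ^ 'M) set"
  assumes T: "Vector_Spaces.linear (*s) (*s) T" and C: "orthonormal_basis_of H C"
  shows "hs_norm_on H T = sqrt (\<Sum>c\<in>C. (norm (T c))\<^sup>2)"
proof -
  interpret T: Vector_Spaces.linear "(*s)" "(*s)" T by (rule T)
  define B where "B = (SOME B. orthonormal_basis_of H B)"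
  have B: "orthonormal_basis_of H B" unfolding B_def using C by (rule someI)
  have inB: "b \<in> H" if "b \<in> B" for b
    using B that by (auto simp: orthonormal_basis_of_def basis_of_def intro: vec.span_base)
  have inC: "b \<in> H" if "b \<in> C" for b
    using C that by (auto simp: orthonormal_basis_of_def basis_of_def intro: vec.span_base)
  have finC: "finite C"
    using C by (auto simp: orthonormal_basis_of_def basis_of_def vec.finiteI_independent)
  have onC: "ip c d = (if c = d then 1 else 0)" if "c \<in> C" "d \<in> C" for c d
    using C that by (auto simp: orthonormal_basis_of_def)
  have parseval: "(\<Sum>b\<in>B. ip b c * ip d b) = ip d c" if "d \<in> C" for c d
    by (subst (2) orthonormal_expand[OF B inC[OF that]])
      (simp add: ip_sum_left ip_scale_left mult.commute)
  have "of_real (\<Sum>b\<in>B. (norm (T b))\<^sup>2)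
      = (\<Sum>b\<in>B. \<Sum>c\<in>C. \<Sum>d\<in>C. ip b c * ip d b * ip (T c) (T d))"
    unfolding of_real_sum
  proof (intro sum.cong refl)
    fix b assume b: "b \<in> B"
    have "T b = T (\<Sum>c\<in>C. ip b c *s c)" using orthonormal_expand[OF C inB[OF b]] by simp
    then have Tb: "T b = (\<Sum>c\<in>C. ip b c *s T c)" by (simp add: T.sum T.scale)
    have "of_real ((norm (T b))\<^sup>2) = ip (T b) (T b)" by (simp add: ip_self)
    also have "\<dots> = (\<Sum>c\<in>C. \<Sum>d\<in>C. ip b c * ip d b * ip (T c) (T d))"
      unfolding Tb ip_sum_left ip_sum_right ip_scale_left ip_scale_right conjg_ip
      by (subst sum.swap) (simp add: sum_distrib_left mult.assoc mult.left_commute)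
    finally show "of_real ((norm (T b))\<^sup>2)
        = (\<Sum>c\<in>C. \<Sum>d\<in>C. ip b c * ip d b * ip (T c) (T d))" .
  qed
  also have "\<dots> = (\<Sum>c\<in>C. \<Sum>b\<in>B. \<Sum>d\<in>C. ip b c * ip d b * ip (T c) (T d))"
    by (rule sum.swap)
  also have "\<dots> = (\<Sum>c\<in>C. \<Sum>d\<in>C. \<Sum>b\<in>B. ip b c * ip d b * ip (T c) (T d))"
    by (intro sum.cong refl sum.swap)
  also have "\<dots> = (\<Sum>c\<in>C. \<Sum>d\<in>C. if d = c then ip (T c) (T d) else 0)"
    by (intro sum.cong refl) (simp add: sum_distrib_right[symmetric] parseval onC)
  also have "\<dots> = of_real (\<Sum>c\<in>C. (norm (T c))\<^sup>2)"
    using finC by (simp add: ip_self)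
  finally have "(\<Sum>b\<in>B. (norm (T b))\<^sup>2) = (\<Sum>c\<in>C. (norm (T c))\<^sup>2)"
    by (simp only: of_real_eq_iff)
  then show ?thesis by (simp add: hs_norm_on_def B_def[symmetric] Let_def)
qed

end

theory Submission
  imports Defs
begin

text \<open>
  Write \<open>x\<close> for the weight vector extended by zero outside \<open>J\<close>, and \<open>s\<close> for the sum of its
  entries, so that \<open>trace S = s\<close>. Since \<open>trace (P\<^sub>i P\<^sub>j) = |\<langle>\<phi>\<^sub>i, \<phi>\<^sub>j\<rangle>|\<^sup>2\<close>, the entries of the Gram
  matrix are \<open>G\<^sub>i\<^sub>j = |\<langle>\<phi>\<^sub>i, \<phi>\<^sub>j\<rangle>|\<^sup>2 - 1/m\<close> (\<open>gram_matrix_entry\<close>), and therefore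
  \<open>\<parallel>S\<parallel>\<^sub>H\<^sub>S\<^sup>2 = x \<bullet> G x + s\<^sup>2/m\<close> (\<open>hs_norm_S_op\<close>). Tightness of the frame gives \<open>G 1 = 0\<close>, so
  \<open>x\<close> may be replaced in the quadratic form by its projection \<open>v = x - (s/N) 1\<close> onto the
  orthogonal complement of \<open>1\<close>. There \<open>v \<bullet> G v \<ge> \<gamma> \<parallel>v\<parallel>\<^sup>2\<close> by the variational
  characterisation of the smallest eigenvalue (\<open>Min_eigenvalues_on_le\<close>). Finally
  \<open>\<parallel>v\<parallel>\<^sup>2 = \<parallel>x\<parallel>\<^sup>2 - s\<^sup>2/N\<close>, and \<open>\<parallel>x\<parallel>\<^sup>2 \<ge> s\<^sup>2/|J|\<close> by the Cauchy--Schwarz inequality; the two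
  combine because \<open>\<gamma>\<close> is positive.
\<close>

section \<open>The smallest eigenvalue of a symmetric matrix on an invariant subspace\<close>

lemma symmetric_matrix_inner:
  fixes A :: "real ^ 'n ^ 'n"
  assumes "transpose A = A"
  shows "(A *v x) \<bullet> y = x \<bullet> (A *v y)"
  by (metis assms dot_lmul_matrix transpose_matrix_vector)

text \<open>Eigenvectors of a symmetric matrix for distinct eigenvalues are orthogonal, hence
  linearly independent.\<close>

lemma finite_eigenvalues_on:
  fixes A :: "real ^ 'n ^ 'n"
  assumes sym: "transpose A = A"
  shows "finite (eigenvalues_on A V)"
proof -
  define e where "e = (\<lambda>c. SOME v. v \<noteq> 0 \<and> A *v v = c *\<^sub>R v)"
  have e: "e c \<noteq> 0 \<and> A *v e c = c *\<^sub>R e c" if "c \<in> eigenvalues_on A V" for c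
    unfolding e_def by (rule someI_ex) (use that in \<open>auto simp: eigenvalues_on_def\<close>)
  have orth: "e c \<bullet> e d = 0"
    if "c \<in> eigenvalues_on A V" "d \<in> eigenvalues_on A V" "c \<noteq> d" for c d
  proof -
    have "c * (e c \<bullet> e d) = d * (e c \<bullet> e d)"
      using symmetric_matrix_inner[OF sym, of "e c" "e d"] e that by simp
    then show ?thesis using that by simp
  qed
  have "inj_on e (eigenvalues_on A V)"
    using e orth by (metis inj_onI inner_eq_zero_iff)
  moreover have "finite (e ` eigenvalues_on A V)"
  proof -
    have "pairwise orthogonal (e ` eigenvalues_on A V)"
      using orth by (auto simp: pairwise_def orthogonal_def)
    moreover have "0 \<notin> e ` eigenvalues_on A V" using e by force
    ultimately show ?thesis
      by (metis pairwise_orthogonal_independent independent_bound)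
  qed
  ultimately show ?thesis by (rule finite_imageD[rotated])
qed

text \<open>The minimum of the Rayleigh quotient over an invariant subspace is attained, by
  compactness of the unit sphere, and a minimiser is an eigenvector.\<close>

lemma rayleigh_minimiser:
  fixes A :: "real ^ 'n ^ 'n"
  assumes sym: "transpose A = A" and V: "subspace V"
    and inv: "\<And>x. x \<in> V \<Longrightarrow> A *v x \<in> V" and ne: "y \<in> V" "y \<noteq> 0"
  obtains c where "c \<in> eigenvalues_on A V"
    and "\<And>x. x \<in> V \<Longrightarrow> c * (x \<bullet> x) \<le> x \<bullet> (A *v x)"
proof -
  let ?K = "sphere 0 1 \<inter> V"
  have "compact ?K" using closed_subspace[OF V] by (intro compact_Int_closed) auto
  moreover have "(1 / norm y) *\<^sub>R y \<in> ?K" using ne V by (auto intro: subspace_mul)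
  then have "?K \<noteq> {}" by blast
  moreover have "continuous_on ?K (\<lambda>x. x \<bullet> (A *v x))"
    by (intro continuous_intros linear_continuous_on linear_conv_bounded_linear[THEN iffD1]
        matrix_vector_mul_linear)
  ultimately have "\<exists>v\<in>?K. \<forall>x\<in>?K. v \<bullet> (A *v v) \<le> x \<bullet> (A *v x)"
    by (rule continuous_attains_inf)
  then obtain v where v: "v \<in> ?K" and mn: "\<And>x. x \<in> ?K \<Longrightarrow> v \<bullet> (A *v v) \<le> x \<bullet> (A *v x)"
    by blast
  define c where "c = v \<bullet> (A *v v)"
  have vv: "v \<bullet> v = 1" and vV: "v \<in> V" and v0: "v \<noteq> 0" using v by (auto simp: norm_eq_1)
  have low: "c * (x \<bullet> x) \<le> x \<bullet> (A *v x)" if x: "x \<in> V" for x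
  proof (cases "x = 0")
    case False
    have "(1 / norm x) *\<^sub>R x \<in> ?K" using False x V by (auto intro: subspace_mul)
    from mn[OF this] have "c \<le> (x \<bullet> (A *v x)) / (norm x)\<^sup>2"
      by (simp add: c_def matrix_vector_mult_scaleR power2_eq_square)
    then show ?thesis using False by (simp add: field_simps power2_norm_eq_inner)
  qed simp
  define u where "u = A *v v - c *\<^sub>R v"
  have uV: "u \<in> V" unfolding u_def using V vV inv by (intro subspace_diff subspace_mul) auto
  define k where "k = u \<bullet> (A *v u) - c * (u \<bullet> u)"
  have k: "k \<ge> 0" using low[OF uV] by (simp add: k_def)
  \<comment> \<open>The form \<open>x \<bullet> A x - c (x \<bullet> x)\<close> is nonnegative on \<open>V\<close> and vanishes at \<open>v\<close>; expand it at \<open>v + t u\<close>.\<close>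
  have quad: "0 \<le> 2 * t * (u \<bullet> u) + t\<^sup>2 * k" for t
  proof -
    let ?x = "v + t *\<^sub>R u"
    have "?x \<in> V" using V vV uV by (intro subspace_add subspace_mul)
    from low[OF this] have "0 \<le> ?x \<bullet> (A *v ?x) - c * (?x \<bullet> ?x)" by simp
    also have "\<dots> = 2 * t * (u \<bullet> (A *v v) - c * (u \<bullet> v)) + t\<^sup>2 * k"
      using symmetric_matrix_inner[OF sym, of v u]
      by (simp add: matrix_vector_right_distrib matrix_vector_mult_scaleR inner_add_left
          inner_add_right k_def vv c_def[symmetric] power2_eq_square algebra_simps inner_commute)
    also have "u \<bullet> (A *v v) - c * (u \<bullet> v) = u \<bullet> u"
      by (subst (4) u_def) (simp add: inner_diff_right)
    finally show ?thesis .
  qed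
  have "u = 0"
  proof (rule ccontr)
    assume "u \<noteq> 0"
    then have a: "u \<bullet> u > 0" by simp
    let ?a = "u \<bullet> u"
    \<comment> \<open>The linear term dominates for small negative \<open>t\<close>, and \<open>t = - (u \<bullet> u) / (k + 1)\<close> is small enough.\<close>
    have "2 * (- ?a / (k + 1)) * ?a + (- ?a / (k + 1))\<^sup>2 * k = - (?a\<^sup>2 * (k + 2)) / (k + 1)\<^sup>2"
      using k by (simp add: divide_simps power2_eq_square) (simp add: algebra_simps)
    also have "\<dots> < 0" using a k by (intro divide_neg_pos) (simp_all add: mult_pos_pos)
    finally show False using quad[of "- ?a / (k + 1)"] by simp
  qed
  then have "c \<in> eigenvalues_on A V"
    using vV v0 by (auto simp: eigenvalues_on_def u_def)
  with low show thesis using that by blast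
qed

lemma Min_eigenvalues_on_le:
  fixes A :: "real ^ 'n ^ 'n"
  assumes "transpose A = A" and "subspace V"
    and "\<And>x. x \<in> V \<Longrightarrow> A *v x \<in> V" and "x \<in> V"
  shows "Min (eigenvalues_on A V) * (x \<bullet> x) \<le> x \<bullet> (A *v x)"
proof (cases "x = 0")
  case False
  with assms obtain c where c: "c \<in> eigenvalues_on A V" "c * (x \<bullet> x) \<le> x \<bullet> (A *v x)"
    by (metis rayleigh_minimiser)
  have "Min (eigenvalues_on A V) \<le> c" using finite_eigenvalues_on[OF assms(1)] c by simp
  then have "Min (eigenvalues_on A V) * (x \<bullet> x) \<le> c * (x \<bullet> x)" by (simp add: mult_right_mono)
  with c show ?thesis by linarith
qed simp


section \<open>Traces in an orthonormal basis\<close>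

lemma re_of_real [simp]: "re (of_real r :: 'a::real_or_complex) = r"
proof -
  have "of_real (2 * r) = (of_real (2 * re (of_real r :: 'a)) :: 'a)"
    using add_conjg[of "of_real r :: 'a"] by simp
  then show ?thesis by (simp only: of_real_eq_iff)
qed

lemma ip_mult_ip_swap: "ip y x * ip x y = of_real ((norm (ip x y))\<^sup>2)"
  using mult_conjg[of "ip x y"] by (simp add: conjg_ip mult.commute)

lemma scaleR_eq_scale: "r *\<^sub>R x = of_real r *s (x :: 'a::real_or_complex ^ 'M)"
  unfolding vec_eq_iff vector_scaleR_component vector_smult_component
  by (simp add: scaleR_conv_of_real)

lemma ip_scaleR_left: "ip (r *\<^sub>R x) z = of_real r * ip x z"
  by (simp add: scaleR_eq_scale ip_scale_left)

lemma ip_scaleR_right: "ip x (r *\<^sub>R z) = of_real r * ip x z"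
  by (simp add: scaleR_eq_scale ip_scale_right)

lemma ip_diff_left: "ip (x - y) z = ip x z - ip y z"
  by (metis add_diff_cancel diff_add_cancel ip_add_left)

lemma orthonormal_parseval:
  fixes H :: "('a::real_or_complex ^ 'M) set"
  assumes B: "orthonormal_basis_of H B" and x: "x \<in> H"
  shows "(\<Sum>b\<in>B. ip x b * ip b y) = ip x y"
  by (subst (2) orthonormal_expand[OF B x]) (simp add: ip_sum_left ip_scale_left)

lemma representation_orthonormal:
  fixes H :: "('a::real_or_complex ^ 'M) set"
  assumes B: "orthonormal_basis_of H B" and x: "x \<in> H" and c: "c \<in> B"
  shows "vec.representation B x c = ip x c"
proof -
  have ind: "\<not> vec.dependent B" and spn: "vec.span B = H"
    and on: "\<And>b c. b \<in> B \<Longrightarrow> c \<in> B \<Longrightarrow> ip b c = (if b = c then 1 else 0)"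
    using B by (auto simp: orthonormal_basis_of_def basis_of_def)
  have fin: "finite B" using ind by (rule vec.finiteI_independent)
  let ?r = "vec.representation B x"
  have ex: "(\<Sum>b\<in>B. ?r b *s b) = x"
    using vec.sum_representation_eq[OF ind _ fin order_refl] x spn by simp
  have "ip x c = (\<Sum>b\<in>B. ?r b * ip b c)"
    by (subst ex[symmetric]) (simp add: ip_sum_left ip_scale_left)
  also have "\<dots> = (\<Sum>b\<in>B. if b = c then ?r b else 0)"
    using on c by (intro sum.cong) auto
  finally show ?thesis using fin c by simp
qed

lemma trace_on_orthonormal:
  fixes H :: "('a::real_or_complex ^ 'M) set"
  assumes T: "Vector_Spaces.linear (*s) (*s) T" and TH: "\<And>x. x \<in> H \<Longrightarrow> T x \<in> H"
    and B: "orthonormal_basis_of H B"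
  shows "trace_on H T = (\<Sum>b\<in>B. ip (T b) b)"
proof -
  have B': "basis_of H B" using B by (simp add: orthonormal_basis_of_def)
  then have inB: "b \<in> H" if "b \<in> B" for b
    using that by (auto simp: basis_of_def intro: vec.span_base)
  show ?thesis
    using trace_on_eq[OF T TH B'] representation_orthonormal[OF B TH[OF inB]] by simp
qed

lemma linear_Q_op: "Vector_Spaces.linear (*s) (*s) (Q_op H \<phi> i)"
  by unfold_locales (simp_all add: Q_op_def P_op_def ip_add_left ip_scale_left
      scaleR_eq_scale vec.scale_left_distrib vec.scale_right_distrib vec.scale_right_diff_distrib
      algebra_simps)

lemma linear_S_op: "Vector_Spaces.linear (*s) (*s) (S_op \<phi> J w)"
  by unfold_locales (simp_all add: S_op_def P_op_def ip_add_left ip_scale_left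
      scaleR_eq_scale vec.scale_left_distrib vec.scale_right_distrib sum.distrib
      vec.scale_sum_right algebra_simps)

lemma P_op_mem:
  assumes "vec.subspace H" and "\<phi> i \<in> H"
  shows "P_op \<phi> i a \<in> H"
  using assms by (simp add: P_op_def vec.subspace_scale)


section \<open>The Gram matrix and the operator of a unit-norm tight frame\<close>

context
  fixes H :: "('a::real_or_complex ^ 'M) set" and \<phi> :: "'N::finite \<Rightarrow> 'a ^ 'M"
  assumes H: "vec.subspace H" and frame: "unit_norm_tight_frame H \<phi>"
begin

lemma frame_mem: "\<phi> i \<in> H"
  using frame by (simp add: unit_norm_tight_frame_def)

lemma frame_ip_self: "ip (\<phi> i) (\<phi> i) = 1"
  using frame by (simp add: unit_norm_tight_frame_def ip_self)

lemma frame_dim_pos: "vec.dim H > 0"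
proof (rule ccontr)
  assume "\<not> vec.dim H > 0"
  then have "H \<subseteq> {0}" using vec.dim_eq_0 by simp
  then have "\<phi> undefined = 0" using frame_mem by blast
  then show False using frame_ip_self[of undefined] by simp
qed

lemma gram_matrix_entry:
  "gram_matrix H \<phi> $ i $ j = (norm (ip (\<phi> i) (\<phi> j)))\<^sup>2 - 1 / real (vec.dim H)"
proof -
  define m where "m = real (vec.dim H)"
  have m: "m > 0" using frame_dim_pos by (simp add: m_def)
  obtain B where B: "orthonormal_basis_of H B" using orthonormal_basis_exists[OF H] by blast
  have ind: "\<not> vec.dependent B" and spn: "vec.span B = H"
    and on: "\<And>b c. b \<in> B \<Longrightarrow> c \<in> B \<Longrightarrow> ip b c = (if b = c then 1 else 0)"
    using B by (auto simp: orthonormal_basis_of_def basis_of_def)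
  have card: "real (card B) = m" unfolding m_def
    by (metis ind spn vec.dim_span_eq_card_independent)
  have tr0: "(\<Sum>b\<in>B. ip b b) = of_real m"
    using on by (simp flip: card)
  have Qmem: "Q_op H \<phi> k x \<in> H" if "x \<in> H" for k x
    using that H frame_mem unfolding Q_op_def scaleR_eq_scale
    by (intro vec.subspace_diff P_op_mem vec.subspace_scale)
  have tr1: "(\<Sum>b\<in>B. ip (P_op \<phi> k b) b) = 1" for k
    using orthonormal_parseval[OF B frame_mem[of k], of "\<phi> k"]
    by (simp add: P_op_def ip_scale_left frame_ip_self mult.commute)
  have tr2: "(\<Sum>b\<in>B. ip (P_op \<phi> i (P_op \<phi> j b)) b) = of_real ((norm (ip (\<phi> i) (\<phi> j)))\<^sup>2)"
  proof -
    have "(\<Sum>b\<in>B. ip (P_op \<phi> i (P_op \<phi> j b)) b)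
        = ip (\<phi> j) (\<phi> i) * (\<Sum>b\<in>B. ip (\<phi> i) b * ip b (\<phi> j))"
      by (simp add: P_op_def ip_scale_left sum_distrib_left mult_ac)
    then show ?thesis
      using ip_mult_ip_swap[of "\<phi> j" "\<phi> i"] orthonormal_parseval[OF B frame_mem] by simp
  qed
  have "trace_on H (Q_op H \<phi> i \<circ> Q_op H \<phi> j) = (\<Sum>b\<in>B. ip (Q_op H \<phi> i (Q_op H \<phi> j b)) b)"
    by (subst trace_on_orthonormal[OF _ _ B])
      (auto intro!: Vector_Spaces.linear_compose[OF linear_Q_op linear_Q_op] Qmem)
  also have "\<dots> = (\<Sum>b\<in>B. ip (P_op \<phi> i (P_op \<phi> j b)) b - of_real (1 / m) * ip (P_op \<phi> i b) b
      - of_real (1 / m) * ip (P_op \<phi> j b) b + of_real ((1 / m)\<^sup>2) * ip b b)"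
    unfolding Q_op_def P_op_def m_def[symmetric] ip_diff_left ip_scale_left ip_scaleR_left
    by (intro sum.cong refl)
      (simp only: power2_eq_square of_real_mult ring_distribs diff_diff_eq2
        mult_ac diff_add_eq)
  also have "\<dots> = of_real ((norm (ip (\<phi> i) (\<phi> j)))\<^sup>2) - of_real (1 / m) - of_real (1 / m)
      + of_real ((1 / m)\<^sup>2) * of_real m"
    by (simp only: sum.distrib sum_subtractf sum_distrib_left[symmetric] tr1 tr2 tr0 mult_1_right)
  also have "\<dots> = of_real ((norm (ip (\<phi> i) (\<phi> j)))\<^sup>2 - 1 / m - 1 / m + (1 / m)\<^sup>2 * m)"
    by (simp only: of_real_add of_real_diff of_real_mult)
  also have "(norm (ip (\<phi> i) (\<phi> j)))\<^sup>2 - 1 / m - 1 / m + (1 / m)\<^sup>2 * m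
      = (norm (ip (\<phi> i) (\<phi> j)))\<^sup>2 - 1 / m"
    using m by (simp add: power2_eq_square)
  finally have "trace_on H (Q_op H \<phi> i \<circ> Q_op H \<phi> j)
      = of_real ((norm (ip (\<phi> i) (\<phi> j)))\<^sup>2 - 1 / m)" .
  then show ?thesis
    unfolding gram_matrix_def m_def[symmetric] vec_lambda_beta by (simp only: re_of_real)
qed

lemma transpose_gram_matrix: "transpose (gram_matrix H \<phi>) = gram_matrix H \<phi>"
proof -
  have "(norm (ip x y))\<^sup>2 = (norm (ip y x))\<^sup>2" for x y :: "'a ^ 'M"
    using ip_mult_ip_swap[of x y] ip_mult_ip_swap[of y x]
    by (metis mult.commute of_real_eq_iff)
  then show ?thesis by (simp add: vec_eq_iff transpose_def gram_matrix_entry)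
qed

lemma gram_matrix_ones: "gram_matrix H \<phi> *v 1 = 0"
proof -
  have "(\<Sum>j\<in>UNIV. (norm (ip (\<phi> i) (\<phi> j)))\<^sup>2) = real CARD('N) / real (vec.dim H)" for i
    using frame by (simp add: unit_norm_tight_frame_def)
  then show ?thesis
    by (simp add: vec_eq_iff matrix_vector_mult_def gram_matrix_entry sum_subtractf)
qed

lemma trace_S_op: "trace_on H (S_op \<phi> J w) = of_real (sum w J)"
proof -
  obtain B where B: "orthonormal_basis_of H B" using orthonormal_basis_exists[OF H] by blast
  have "S_op \<phi> J w x \<in> H" for x
    using H frame_mem unfolding S_op_def scaleR_eq_scale
    by (intro vec.subspace_sum P_op_mem vec.subspace_scale)
  then have "trace_on H (S_op \<phi> J w) = (\<Sum>b\<in>B. ip (S_op \<phi> J w b) b)"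
    using trace_on_orthonormal[OF linear_S_op _ B] by blast
  also have "\<dots> = (\<Sum>i\<in>J. of_real (w i) * (\<Sum>b\<in>B. ip (\<phi> i) b * ip b (\<phi> i)))"
    by (simp add: S_op_def P_op_def ip_sum_left ip_scaleR_left ip_scale_left sum_distrib_left
        mult_ac) (rule sum.swap)
  also have "\<dots> = of_real (sum w J)"
    by (simp add: orthonormal_parseval[OF B frame_mem] frame_ip_self)
  finally show ?thesis .
qed

lemma hs_norm_S_op:
  "(hs_norm_on H (S_op \<phi> J w))\<^sup>2
     = (\<Sum>i\<in>J. \<Sum>j\<in>J. w i * w j * (norm (ip (\<phi> i) (\<phi> j)))\<^sup>2)"
proof -
  obtain B where B: "orthonormal_basis_of H B" using orthonormal_basis_exists[OF H] by blast
  have "of_real (\<Sum>b\<in>B. (norm (S_op \<phi> J w b))\<^sup>2) = (\<Sum>b\<in>B. ip (S_op \<phi> J w b) (S_op \<phi> J w b))"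
    by (simp add: ip_self)
  also have "\<dots> = (\<Sum>b\<in>B. \<Sum>i\<in>J. \<Sum>j\<in>J.
      of_real (w i * w j) * ip (\<phi> j) (\<phi> i) * (ip (\<phi> i) b * ip b (\<phi> j)))"
    by (simp add: S_op_def P_op_def ip_sum_left ip_sum_right ip_scaleR_left ip_scaleR_right
        ip_scale_left ip_scale_right conjg_ip sum_distrib_left mult_ac)
  also have "\<dots> = (\<Sum>i\<in>J. \<Sum>j\<in>J. \<Sum>b\<in>B.
      of_real (w i * w j) * ip (\<phi> j) (\<phi> i) * (ip (\<phi> i) b * ip b (\<phi> j)))"
    by (subst sum.swap) (intro sum.cong refl sum.swap)
  also have "\<dots> = (\<Sum>i\<in>J. \<Sum>j\<in>J. of_real (w i * w j) * (ip (\<phi> j) (\<phi> i) * ip (\<phi> i) (\<phi> j)))"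
    unfolding sum_distrib_left[symmetric] orthonormal_parseval[OF B frame_mem] mult.assoc ..
  also have "\<dots> = of_real (\<Sum>i\<in>J. \<Sum>j\<in>J. w i * w j * (norm (ip (\<phi> i) (\<phi> j)))\<^sup>2)"
    by (simp only: ip_mult_ip_swap of_real_mult of_real_sum)
  finally have eq: "(\<Sum>b\<in>B. (norm (S_op \<phi> J w b))\<^sup>2)
      = (\<Sum>i\<in>J. \<Sum>j\<in>J. w i * w j * (norm (ip (\<phi> i) (\<phi> j)))\<^sup>2)"
    by (simp only: of_real_eq_iff)
  show ?thesis
    unfolding eq[symmetric] by (simp add: hs_norm_on_eq[OF linear_S_op B] sum_nonneg)
qed

text \<open>The left-hand side is \<open>\<gamma> \<parallel>v\<parallel>\<^sup>2\<close> for the projection \<open>v = x - t 1\<close> onto the orthogonal complement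
  of \<open>1\<close>, where \<open>t\<close> is the mean of the entries of \<open>x\<close>; the quadratic form takes the same value at
  \<open>x\<close> and at \<open>v\<close>, since \<open>G\<close> is symmetric and \<open>G 1 = 0\<close>.\<close>

lemma gamma_frame_quadratic_form:
  fixes x :: "real ^ 'N"
  shows "gamma_frame H \<phi> * (x \<bullet> x - (\<Sum>i\<in>UNIV. x $ i)\<^sup>2 / real CARD('N))
           \<le> x \<bullet> (gram_matrix H \<phi> *v x)"
proof -
  let ?G = "gram_matrix H \<phi>" and ?V = "{1 :: real ^ 'N}\<^sup>\<bottom>" and ?n = "real CARD('N)"
  define s where "s = (\<Sum>i\<in>UNIV. x $ i)"
  define v where "v = x - (s / ?n) *\<^sub>R 1"
  have ones: "1 \<bullet> y = (\<Sum>i\<in>UNIV. y $ i)" for y :: "real ^ 'N" by (simp add: inner_vec_def)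
  have s: "1 \<bullet> x = s" by (simp add: ones s_def)
  have nn: "(1 :: real ^ 'N) \<bullet> 1 = ?n" by (simp add: ones)
  have memV: "y \<in> ?V \<longleftrightarrow> 1 \<bullet> y = 0" for y
    by (simp add: orthogonal_comp_def orthogonal_def)
  have G1: "1 \<bullet> (?G *v y) = 0" for y
    using symmetric_matrix_inner[OF transpose_gram_matrix, of 1 y] by (simp add: gram_matrix_ones)
  have vV: "v \<in> ?V" by (simp add: memV v_def inner_diff_right s nn)
  have "gamma_frame H \<phi> * (v \<bullet> v) \<le> v \<bullet> (?G *v v)"
    unfolding gamma_frame_def
    using Min_eigenvalues_on_le[OF transpose_gram_matrix subspace_orthogonal_comp _ vV]
    by (simp add: memV G1)
  also have "?G *v v = ?G *v x"
    by (simp add: v_def matrix_vector_mult_diff_distrib matrix_vector_mult_scaleR gram_matrix_ones)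
  also have "v \<bullet> (?G *v x) = x \<bullet> (?G *v x)"
    by (simp add: v_def inner_diff_left G1)
  also have "v \<bullet> v = x \<bullet> x - s\<^sup>2 / ?n"
    by (simp add: v_def inner_diff_left inner_diff_right s nn inner_commute[of x 1]
        power2_eq_square)
  finally show ?thesis by (simp add: s_def)
qed

end

theorem lemma2p2:
  fixes H :: "('a::real_or_complex ^ 'M) set"
    and \<phi> :: "'N::finite \<Rightarrow> 'a ^ 'M"
    and m :: nat
    and J :: "'N set"
    and w :: "'N \<Rightarrow> real"
  assumes "CARD('N) \<ge> 2"
    and "vec.subspace H"
    and "vec.dim H = m"
    and "unit_norm_tight_frame H \<phi>"
    and "gamma_frame H \<phi> > 0"
    and "J \<noteq> {}"
    and "\<And>i. i \<in> J \<Longrightarrow> w i > 0"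
  shows "(hs_norm_on H (S_op \<phi> J w))\<^sup>2 / (re (trace_on H (S_op \<phi> J w)))\<^sup>2
           \<ge> 1 / real m + gamma_frame H \<phi> * (1 / real (card J) - 1 / real CARD('N))"
proof -
  let ?g = "gamma_frame H \<phi>" and ?n = "real CARD('N)"
  define x :: "real ^ 'N" where "x = (\<chi> i. if i \<in> J then w i else 0)"
  define s where "s = sum w J"
  have s: "s > 0" unfolding s_def using assms by (intro sum_pos) auto
  have restrict: "(\<Sum>i\<in>UNIV. x $ i * f i) = (\<Sum>i\<in>J. w i * f i)" for f :: "'N \<Rightarrow> real"
  proof -
    have "(\<Sum>i\<in>UNIV. x $ i * f i) = (\<Sum>i\<in>J. x $ i * f i)"
      by (rule sum.mono_neutral_right) (auto simp: x_def)
    then show ?thesis by (simp add: x_def)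
  qed
  have xs: "(\<Sum>i\<in>UNIV. x $ i) = s" using restrict[of "\<lambda>_. 1"] by (simp add: s_def)
  have "x \<bullet> (gram_matrix H \<phi> *v x)
      = (\<Sum>i\<in>J. w i * (\<Sum>j\<in>J. w j * ((norm (ip (\<phi> i) (\<phi> j)))\<^sup>2 - 1 / real m)))"
    by (simp add: inner_vec_def matrix_vector_mult_def restrict mult.commute[of _ "x $ _"]
        gram_matrix_entry[OF assms(2,4)] assms(3))
  also have "\<dots> = (hs_norm_on H (S_op \<phi> J w))\<^sup>2 - s\<^sup>2 / real m"
    unfolding hs_norm_S_op[OF assms(2,4)] s_def power2_eq_square[of "sum w J"] sum_product
    by (simp add: sum_distrib_left sum_divide_distrib sum_subtractf right_diff_distrib mult_ac)
  finally have quad: "(hs_norm_on H (S_op \<phi> J w))\<^sup>2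
      = s\<^sup>2 / real m + x \<bullet> (gram_matrix H \<phi> *v x)" by simp
  have cJ: "real (card J) > 0" using assms(6) by (simp add: card_gt_0_iff)
  have "x \<bullet> x = (\<Sum>i\<in>J. w i * x $ i)" by (simp add: inner_vec_def restrict)
  also have "\<dots> = (\<Sum>i\<in>J. (w i)\<^sup>2)" by (simp add: x_def power2_eq_square)
  finally have "s\<^sup>2 / card J \<le> x \<bullet> x"
    using sum_squared_le_sum_of_squares[of w J] cJ by (simp add: s_def field_simps)
  then have "?g * (s\<^sup>2 / card J - s\<^sup>2 / ?n) \<le> ?g * (x \<bullet> x - s\<^sup>2 / ?n)"
    using assms(5) by (intro mult_left_mono) auto
  also have "\<dots> \<le> x \<bullet> (gram_matrix H \<phi> *v x)"
    using gamma_frame_quadratic_form[OF assms(2,4), of x] by (simp add: xs)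
  finally have "s\<^sup>2 / real m + ?g * (s\<^sup>2 / card J - s\<^sup>2 / ?n) \<le> (hs_norm_on H (S_op \<phi> J w))\<^sup>2"
    using quad by simp
  moreover have "s\<^sup>2 / real m + ?g * (s\<^sup>2 / card J - s\<^sup>2 / ?n)
      = (1 / real m + ?g * (1 / real (card J) - 1 / ?n)) * s\<^sup>2"
    by (simp add: algebra_simps)
  ultimately have "1 / real m + ?g * (1 / real (card J) - 1 / ?n)
      \<le> (hs_norm_on H (S_op \<phi> J w))\<^sup>2 / s\<^sup>2"
    using s by (simp add: pos_le_divide_eq)
  then show ?thesis
    using trace_S_op[OF assms(2,4), of J w] by (simp add: s_def del: of_real_sum)
qed

end
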